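(* Let the initial value problem $u_t=F(t,u,u_x,\dots)$ in $\Omega\times(0,T]$, $u=u_0$ at $t=0$, be locally well-posed around a nominal trajectory $u(t)$, and let its approximation scheme $(F^N,P^N,\Phi^N)_{N\ge N_0}$ be well-posed (both in the sense defined in the context). Suppose the output map $\mathcal{H}$ is continuous (in the sense defined in the context) in $C^0\big([0,T],\bigcup_{N=N_0}^\infty \Phi^N(\mathbb{R}^N)\big)$ for some integer $N_0>0$. Let $\rho>0$, and let the nominal trajectory satisfy $u(0)\in W\cap D_0$, with the sphere $\{w\in W:\|w-u(0)\|_X=\rho\}$ contained in $D_0$. Let $u^N(t)$ be the corresponding trajectory of $du^N/dt=F^N(t,u^N)$ with initial value $u^N(0)=P^N(u(0))$. Assume that the sphere $\{w\in W^N:\|w-u^N(0)\|_N=\rho\}$ is contained in $P^N(D_0)$ for every $N\ge N_0$. Let $\epsilon$ and $\epsilon^N$ be the quantities defined in the context for the trajectories $u$ and $u^N$ at level $\rho$. Then $$\lim_{N\to\infty}\epsilon^N=\epsilon .$$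
   Context: **PDE.** $\Omega\subset\mathbb{R}^n$ is open, $T>0$, $X$ is a Banach space of functions on $\Omega$ with norm $\|\cdot\|_X$, $V_0$ is a subspace of $X$ (containing the initial conditions), and $V$ is a subspace of $C^0([0,T],X)$ (the solution space; if boundary conditions are imposed, all functions in $V$ satisfy them). The initial value problem is $$u_t=F(t,u,u_x,\dots)\ \text{in }\Omega\times(0,T],\qquad u=u_0\ \text{at } t=0,$$ where $F$ is a continuous function of $t$, $u$ and the derivatives of $u$ with respect to $x$; solutions (strict or weak) are $X$-valued functions $u(t)=u(\cdot,t)$ belonging to $V$. **Local well-posedness of the PDE around a nominal trajectory $u(t)$.** There is an open neighborhood $D_0\subset V_0$ of $u(0)$ such that for every $u_0\in D_0$ the problem has a solution in $V$, the solution is unique, and the solution depends continuously on its initial value (as a map from $D_0$ with the norm $\|\cdot\|_X$ to $C^0([0,T],X)$ with the sup norm). **Output.** $\mathcal{H}:X\to\mathbb{R}^p$ is a (linear or nonlinear) map; for $v\in C^0([0,T],X)$ put $y_v(t)=\mathcal{H}(v(t))$. Outputs lie in a normed space of functions from a time interval $[t_0,t_1]\subseteq[0,T]$ to $\mathbb{R}^p$, with norm $\|\cdot\|_Y$. $\mathcal{H}$ is called continuous in a subset $S$ of $C^0([0,T],X)$ if for any sequence $\{u_k(t)\}$ in $S$ and any $u\in V$: $u_k(t)\to u(t)$ in $X$ uniformly on $[0,T]$ implies $\lim_{k\to\infty}\|y_{u_k}-y_u\|_Y=0$. **Space for estimation.** $W=\mathrm{span}\{e_1,\dots,e_s\}$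 is an $s$-dimensional subspace of $V_0$ with basis $e_1,\dots,e_s$, $s\ge1$. **Quantity $\epsilon$.** For a nominal trajectory $u$ with $u(0)\in W\cap D_0$ and $\rho>0$ with $\{w\in W:\|w-u(0)\|_X=\rho\}\subset D_0$, $$\epsilon=\inf\|y_{\hat u}-y_u\|_Y,$$ the infimum over all solutions $\hat u$ of $\hat u_t=F(t,\hat u,\hat u_x,\dots)$ with $\hat u(0)\in W\cap D_0$ and $\|\hat u(0)-u(0)\|_X=\rho$. ($\rho/\epsilon$ is the unobservability index.) **Approximation scheme.** For integers $N\ge N_0$: ODE systems $du^N/dt=F^N(t,u^N)$, $u^N\in\mathbb{R}^N$, having solutions on $[0,T]$ for initial values in $P^N(D_0)$; linear maps $P^N:V_0\to\mathbb{R}^N$ and $\Phi^N:\mathbb{R}^N\to X$; and norms $\|\cdot\|_N$ on $\mathbb{R}^N$. The scheme is well-posed if: (1) for any bounded set $B$ in $D_0$ there exist $M>0$ and $\alpha>0$ such that for all $N$ and any PDE solution $u$ with $u(0)\in B$, $\|u(t)-\Phi^N(u^N(t))\|_X\le M/N^\alpha$ for all $t\in[0,T]$, where $u^N$ is any solution of the ODE with $u^N(0)=P^N(u(0))$; (2) for any $u\in W$, $\|u\|_X=\|P^N(u)\|_N+a_N\|P^N(u)\|_N$ with real numbers $a_N$ (possibly depending on $u$) satisfying $\lim_{N\to\infty}a_N=0$. $W^N=P^N(W)\subseteq\mathbb{R}^N$. **Quantity $\epsilon^N$.** For a trajectory $u^N(t)$ of the ODE with $u^N(0)\in W^N$, $$\epsilon^N=\inf\|\hat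 y^N-y^N\|_Y,\qquad \hat y^N(t)=\mathcal{H}(\Phi^N(\hat u^N(t))),\quad y^N(t)=\mathcal{H}(\Phi^N(u^N(t))),$$ the infimum over all solutions $\hat u^N$ of $d\hat u^N/dt=F^N(t,\hat u^N)$ with $\hat u^N(0)\in W^N$ and $\|\hat u^N(0)-u^N(0)\|_N=\rho$. *)

theory Defs
  imports "HOL-Analysis.Analysis" "Jordan_Normal_Form.Matrix"
begin

text \<open>The notation for components belongs to \<open>real vec\<close> below; the type \<open>real ^ 'n\<close> is used only
  for points of space and for output values.\<close>

unbundle no vec_syntax

section \<open>Function spaces\<close>

text \<open>A normed space \<open>'v\<close> of functions on \<open>S\<close>: \<open>E\<close> is the set of admissible functions, and \<open>cls f\<close> is
  the element of \<open>'v\<close> given by \<open>f\<close>. The map \<open>cls\<close> need not be injective on functions on \<open>S\<close>, so that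
  spaces of functions modulo null sets, such as \<open>L\<^sup>2(S)\<close>, are included. Values outside \<open>S\<close> are
  irrelevant.\<close>

definition function_space ::
    "'a set \<Rightarrow> ('a \<Rightarrow> 'b::real_vector) set \<Rightarrow> (('a \<Rightarrow> 'b) \<Rightarrow> 'v::real_normed_vector) \<Rightarrow> bool" where
  "function_space S E cls \<longleftrightarrow>
     (\<lambda>x. 0) \<in> E \<and>
     (\<forall>f\<in>E. \<forall>g\<in>E. (\<lambda>x. f x + g x) \<in> E \<and> cls (\<lambda>x. f x + g x) = cls f + cls g) \<and>
     (\<forall>c. \<forall>f\<in>E. (\<lambda>x. c *\<^sub>R f x) \<in> E \<and> cls (\<lambda>x. c *\<^sub>R f x) = c *\<^sub>R cls f) \<and>
     (\<forall>f\<in>E. \<forall>g. (\<forall>x\<in>S. g x = f x) \<longrightarrow> g \<in> E \<and> cls g = cls f) \<and>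
     cls ` E = UNIV"

text \<open>Elements of \<open>C\<^sup>0([0,T],A)\<close> are represented by functions on \<open>real\<close> whose values outside \<open>[0,T]\<close>
  are irrelevant; sets of such functions are therefore taken to be closed under changes outside
  \<open>[0,T]\<close>.\<close>

definition C0 :: "real \<Rightarrow> 'x::real_normed_vector set \<Rightarrow> (real \<Rightarrow> 'x) set" where
  "C0 T A = {v. continuous_on {0..T} v \<and> v ` {0..T} \<subseteq> A}"

definition sup_norm :: "real \<Rightarrow> (real \<Rightarrow> 'x::real_normed_vector) \<Rightarrow> real" where
  "sup_norm T v = (SUP t\<in>{0..T}. norm (v t))"

definition respects_interval :: "real \<Rightarrow> (real \<Rightarrow> 'x) set \<Rightarrow> bool" where
  "respects_interval T A \<longleftrightarrow> (\<forall>u\<in>A. \<forall>v. (\<forall>t\<in>{0..T}. v t = u t) \<longrightarrow> v \<in> A)"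

definition subspace_of_C0 :: "real \<Rightarrow> (real \<Rightarrow> 'x::real_normed_vector) set \<Rightarrow> bool" where
  "subspace_of_C0 T V \<longleftrightarrow>
     V \<subseteq> C0 T UNIV \<and> respects_interval T V \<and>
     (\<lambda>t. 0) \<in> V \<and>
     (\<forall>u\<in>V. \<forall>v\<in>V. (\<lambda>t. u t + v t) \<in> V) \<and>
     (\<forall>c. \<forall>u\<in>V. (\<lambda>t. c *\<^sub>R u t) \<in> V)"

section \<open>The initial value problem\<close>

primrec partial_deriv ::
    "'n list \<Rightarrow> (real ^ 'n::finite \<Rightarrow> 'b::real_normed_vector) \<Rightarrow> real ^ 'n \<Rightarrow> 'b" where
  "partial_deriv [] f = f"
| "partial_deriv (i # \<alpha>) f =
     (\<lambda>x. vector_derivative (\<lambda>h. partial_deriv \<alpha> f (x + h *\<^sub>R axis i 1)) (at 0))"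

definition C_order ::
    "nat \<Rightarrow> (real ^ 'n::finite) set \<Rightarrow> (real ^ 'n \<Rightarrow> 'b::real_normed_vector) \<Rightarrow> bool" where
  "C_order r \<Omega> f \<longleftrightarrow>
     (\<forall>\<alpha> i. length \<alpha> < r \<longrightarrow>
        (\<forall>x\<in>\<Omega>. (\<lambda>h. partial_deriv \<alpha> f (x + h *\<^sub>R axis i 1)) differentiable (at 0))) \<and>
     (\<forall>\<alpha>. length \<alpha> \<le> r \<longrightarrow> continuous_on \<Omega> (partial_deriv \<alpha> f))"

text \<open>The right-hand side \<open>F(t, u, u\<^sub>x, \<dots>)\<close> takes the time and the family of all partial derivatives
  \<open>\<alpha> \<mapsto> \<partial>\<^sup>\<alpha>u(x)\<close>, of which only those of order at most \<open>r\<close> (including \<open>u\<close> itself, \<open>\<alpha> = []\<close>) matter.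
  Continuity refers to the product topology on families, which for such \<open>F\<close> is continuity in finitely
  many variables.\<close>

definition pde_rhs ::
    "real \<Rightarrow> nat \<Rightarrow> (real \<Rightarrow> ('n list \<Rightarrow> 'b::euclidean_space) \<Rightarrow> 'b) \<Rightarrow> bool" where
  "pde_rhs T r F \<longleftrightarrow>
     continuous_on ({0..T} \<times> UNIV) (\<lambda>(t, j). F t j) \<and>
     (\<forall>t j j'. (\<forall>\<alpha>. length \<alpha> \<le> r \<longrightarrow> j \<alpha> = j' \<alpha>) \<longrightarrow> F t j = F t j')"

text \<open>A strict solution has representatives \<open>U t\<close> of \<open>u t\<close> that satisfy the equation pointwise in
  \<open>\<Omega> \<times> (0,T]\<close>.\<close>

definition strict_solution ::
    "(real ^ 'n::finite) set \<Rightarrow> real \<Rightarrow> (real ^ 'n \<Rightarrow> 'b::euclidean_space) set \<Rightarrow>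
     ((real ^ 'n \<Rightarrow> 'b) \<Rightarrow> 'x) \<Rightarrow> nat \<Rightarrow> (real \<Rightarrow> ('n list \<Rightarrow> 'b) \<Rightarrow> 'b) \<Rightarrow> (real \<Rightarrow> 'x) \<Rightarrow> bool" where
  "strict_solution \<Omega> T fnsX clsX r F u \<longleftrightarrow>
     (\<exists>U. (\<forall>t\<in>{0..T}. U t \<in> fnsX \<and> clsX (U t) = u t) \<and>
          (\<forall>t\<in>{0<..T}. C_order r \<Omega> (U t)) \<and>
          (\<forall>t\<in>{0<..T}. \<forall>x\<in>\<Omega>.
             ((\<lambda>s. U s x) has_vector_derivative F t (\<lambda>\<alpha>. partial_deriv \<alpha> (U t) x))
               (at t within {0..T})))"

text \<open>The set \<open>Sol\<close> of solutions in \<open>V\<close> may be that of strict solutions or that of weak solutions in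
  any sense; the only requirement on a weak notion is that it admits all strict solutions in \<open>V\<close>.\<close>

definition pde_solutions ::
    "(real ^ 'n::finite) set \<Rightarrow> real \<Rightarrow> (real ^ 'n \<Rightarrow> 'b::euclidean_space) set \<Rightarrow>
     ((real ^ 'n \<Rightarrow> 'b) \<Rightarrow> 'x) \<Rightarrow> nat \<Rightarrow> (real \<Rightarrow> ('n list \<Rightarrow> 'b) \<Rightarrow> 'b) \<Rightarrow>
     (real \<Rightarrow> 'x) set \<Rightarrow> (real \<Rightarrow> 'x) set \<Rightarrow> bool" where
  "pde_solutions \<Omega> T fnsX clsX r F V Sol \<longleftrightarrow>
     Sol \<subseteq> V \<and> respects_interval T Sol \<and>
     (\<forall>u\<in>V. strict_solution \<Omega> T fnsX clsX r F u \<longrightarrow> u \<in> Sol)"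

definition locally_well_posed ::
    "real \<Rightarrow> 'x::real_normed_vector set \<Rightarrow> (real \<Rightarrow> 'x) set \<Rightarrow> 'x set \<Rightarrow> (real \<Rightarrow> 'x) \<Rightarrow> bool" where
  "locally_well_posed T V0 Sol D0 u \<longleftrightarrow>
     openin (top_of_set V0) D0 \<and> u 0 \<in> D0 \<and>
     (\<forall>u0\<in>D0. \<exists>v\<in>Sol. v 0 = u0) \<and>
     (\<forall>v\<in>Sol. \<forall>w\<in>Sol. v 0 \<in> D0 \<and> w 0 = v 0 \<longrightarrow> (\<forall>t\<in>{0..T}. w t = v t)) \<and>
     (\<forall>v\<in>Sol. v 0 \<in> D0 \<longrightarrow>
        (\<forall>\<epsilon>>0. \<exists>\<delta>>0. \<forall>w\<in>Sol. w 0 \<in> D0 \<and> norm (w 0 - v 0) < \<delta> \<longrightarrow>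
           sup_norm T (\<lambda>t. w t - v t) < \<epsilon>))"

section \<open>Outputs\<close>

definition output_dist ::
    "((real \<Rightarrow> 'q::real_vector) \<Rightarrow> 'y::real_normed_vector) \<Rightarrow> ('x \<Rightarrow> 'q) \<Rightarrow>
     (real \<Rightarrow> 'x) \<Rightarrow> (real \<Rightarrow> 'x) \<Rightarrow> real" where
  "output_dist clsY H v w = norm (clsY (\<lambda>t. H (v t) - H (w t)))"

definition output_continuous_in ::
    "real \<Rightarrow> (real \<Rightarrow> 'x::real_normed_vector) set \<Rightarrow>
     ((real \<Rightarrow> 'q::real_vector) \<Rightarrow> 'y::real_normed_vector) \<Rightarrow> ('x \<Rightarrow> 'q) \<Rightarrow>
     (real \<Rightarrow> 'x) set \<Rightarrow> bool" where
  "output_continuous_in T V clsY H S \<longleftrightarrow>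
     (\<forall>uk u. (\<forall>k. uk k \<in> S) \<and> u \<in> V \<and> uniform_limit {0..T} uk u sequentially \<longrightarrow>
        (\<lambda>k. output_dist clsY H (uk k) u) \<longlonglongrightarrow> 0)"

definition obs_eps ::
    "((real \<Rightarrow> 'q::real_vector) \<Rightarrow> 'y::real_normed_vector) \<Rightarrow> ('x::real_normed_vector \<Rightarrow> 'q) \<Rightarrow>
     (real \<Rightarrow> 'x) set \<Rightarrow> 'x set \<Rightarrow> 'x set \<Rightarrow> (real \<Rightarrow> 'x) \<Rightarrow> real \<Rightarrow> real" where
  "obs_eps clsY H Sol W D0 u \<rho> =
     Inf {output_dist clsY H v u | v. v \<in> Sol \<and> v 0 \<in> W \<inter> D0 \<and> norm (v 0 - u 0) = \<rho>}"

section \<open>Approximation schemes\<close>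

text \<open>The space \<open>\<real>\<^sup>N\<close> with variable \<open>N\<close> is \<open>carrier_vec N :: real vec set\<close>.\<close>

definition ode_solution ::
    "real \<Rightarrow> nat \<Rightarrow> (real \<Rightarrow> real vec \<Rightarrow> real vec) \<Rightarrow> (real \<Rightarrow> real vec) \<Rightarrow> bool" where
  "ode_solution T N f v \<longleftrightarrow>
     (\<forall>t\<in>{0..T}. v t \<in> carrier_vec N \<and>
        (\<forall>i<N. ((\<lambda>s. v s $ i) has_real_derivative f t (v t) $ i) (at t within {0..T})))"

definition linear_to_vec :: "nat \<Rightarrow> 'x::real_vector set \<Rightarrow> ('x \<Rightarrow> real vec) \<Rightarrow> bool" where
  "linear_to_vec N V0 P \<longleftrightarrow>
     (\<forall>v\<in>V0. P v \<in> carrier_vec N) \<and>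
     (\<forall>v\<in>V0. \<forall>w\<in>V0. P (v + w) = P v + P w) \<and>
     (\<forall>c. \<forall>v\<in>V0. P (c *\<^sub>R v) = c \<cdot>\<^sub>v P v)"

definition linear_from_vec :: "nat \<Rightarrow> (real vec \<Rightarrow> 'x::real_vector) \<Rightarrow> bool" where
  "linear_from_vec N \<Phi> \<longleftrightarrow>
     (\<forall>x\<in>carrier_vec N. \<forall>y\<in>carrier_vec N. \<Phi> (x + y) = \<Phi> x + \<Phi> y) \<and>
     (\<forall>c. \<forall>x\<in>carrier_vec N. \<Phi> (c \<cdot>\<^sub>v x) = c *\<^sub>R \<Phi> x)"

definition vec_norm_on :: "nat \<Rightarrow> (real vec \<Rightarrow> real) \<Rightarrow> bool" where
  "vec_norm_on N nrm \<longleftrightarrow>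
     (\<forall>x\<in>carrier_vec N. nrm x \<ge> 0 \<and> (nrm x = 0 \<longleftrightarrow> x = 0\<^sub>v N)) \<and>
     (\<forall>c. \<forall>x\<in>carrier_vec N. nrm (c \<cdot>\<^sub>v x) = \<bar>c\<bar> * nrm x) \<and>
     (\<forall>x\<in>carrier_vec N. \<forall>y\<in>carrier_vec N. nrm (x + y) \<le> nrm x + nrm y)"

definition approximation_scheme ::
    "real \<Rightarrow> nat \<Rightarrow> 'x::real_normed_vector set \<Rightarrow> 'x set \<Rightarrow>
     (nat \<Rightarrow> real \<Rightarrow> real vec \<Rightarrow> real vec) \<Rightarrow> (nat \<Rightarrow> 'x \<Rightarrow> real vec) \<Rightarrow>
     (nat \<Rightarrow> real vec \<Rightarrow> 'x) \<Rightarrow> (nat \<Rightarrow> real vec \<Rightarrow> real) \<Rightarrow> bool" where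
  "approximation_scheme T N0 V0 D0 FN P \<Phi> nrm \<longleftrightarrow>
     (\<forall>N\<ge>N0.
        (\<forall>t\<in>{0..T}. \<forall>x\<in>carrier_vec N. FN N t x \<in> carrier_vec N) \<and>
        linear_to_vec N V0 (P N) \<and> linear_from_vec N (\<Phi> N) \<and> vec_norm_on N (nrm N) \<and>
        (\<forall>z\<in>P N ` D0. \<exists>v. ode_solution T N (FN N) v \<and> v 0 = z))"

definition well_posed_scheme ::
    "real \<Rightarrow> nat \<Rightarrow> (real \<Rightarrow> 'x::real_normed_vector) set \<Rightarrow> 'x set \<Rightarrow> 'x set \<Rightarrow>
     (nat \<Rightarrow> real \<Rightarrow> real vec \<Rightarrow> real vec) \<Rightarrow> (nat \<Rightarrow> 'x \<Rightarrow> real vec) \<Rightarrow>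
     (nat \<Rightarrow> real vec \<Rightarrow> 'x) \<Rightarrow> (nat \<Rightarrow> real vec \<Rightarrow> real) \<Rightarrow> bool" where
  "well_posed_scheme T N0 Sol D0 W FN P \<Phi> nrm \<longleftrightarrow>
     (\<forall>B. B \<subseteq> D0 \<and> bounded B \<longrightarrow>
        (\<exists>M>0. \<exists>\<alpha>>0. \<forall>N\<ge>N0. \<forall>u\<in>Sol. \<forall>v.
           u 0 \<in> B \<and> ode_solution T N (FN N) v \<and> v 0 = P N (u 0) \<longrightarrow>
           (\<forall>t\<in>{0..T}. norm (u t - \<Phi> N (v t)) \<le> M / real N powr \<alpha>))) \<and>
     (\<forall>w\<in>W. \<exists>a. a \<longlonglongrightarrow> (0::real) \<and>
        (\<forall>N\<ge>N0. norm w = nrm N (P N w) + a N * nrm N (P N w)))"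

definition obs_eps_N ::
    "((real \<Rightarrow> 'q::real_vector) \<Rightarrow> 'y::real_normed_vector) \<Rightarrow> ('x \<Rightarrow> 'q) \<Rightarrow> real \<Rightarrow> nat \<Rightarrow>
     (real \<Rightarrow> real vec \<Rightarrow> real vec) \<Rightarrow> (real vec \<Rightarrow> 'x) \<Rightarrow> (real vec \<Rightarrow> real) \<Rightarrow>
     real vec set \<Rightarrow> (real \<Rightarrow> real vec) \<Rightarrow> real \<Rightarrow> real" where
  "obs_eps_N clsY H T N f \<phi> nrm WN v \<rho> =
     Inf {output_dist clsY H (\<lambda>t. \<phi> (w t)) (\<lambda>t. \<phi> (v t)) | w.
            ode_solution T N f w \<and> w 0 \<in> WN \<and> nrm (w 0 - v 0) = \<rho>}"

end

theory Submission
  imports Defs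
begin

text \<open>On the finite-dimensional space \<open>W\<close> the seminorms \<open>w \<mapsto> \<parallel>P\<^sup>N w\<parallel>\<^sub>N\<close> converge pointwise to the norm,
  hence are equicontinuous and converge uniformly on bounded sets. If \<open>w\<^sub>k \<rightarrow> w\<close> in \<open>W \<inter> D\<^sub>0\<close> and
  \<open>N\<^sub>k \<rightarrow> \<infinity>\<close>, then the ODE trajectories from \<open>P w\<^sub>k\<close>, mapped by \<open>\<Phi>\<close>, converge uniformly to the PDE
  trajectory from \<open>w\<close>: the scheme compares them with the PDE trajectories from \<open>w\<^sub>k\<close>, and those
  depend continuously on \<open>w\<^sub>k\<close>. So the output distances converge. The bound \<open>limsup \<epsilon>\<^sup>N \<le> \<epsilon>\<close>
  follows by rescaling a nearly optimal \<open>w - u(0)\<close> to the \<open>N\<close>-th sphere. For \<open>liminf \<epsilon>\<^sup>N \<ge> \<epsilon>\<close>,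
  nearly optimal initial values of the approximations are bounded in \<open>W\<close>, so a subsequence
  converges to a point of the limiting sphere, which lies in \<open>D\<^sub>0\<close>.\<close>

section \<open>Finite-dimensional subspaces\<close>

text \<open>A convergent sequence is bounded, so some subsequence has its limit in \<open>A\<close>,
  and limits are unique. Kept separate so that the compactness induction below can use closedness of
  the smaller span.\<close>

lemma closed_if_bounded_seq_compact:
  fixes A :: "'a::real_normed_vector set"
  assumes "\<And>x :: nat \<Rightarrow> 'a. (\<And>k. x k \<in> A) \<Longrightarrow> bounded (range x) \<Longrightarrow>
      \<exists>l\<in>A. \<exists>r :: nat \<Rightarrow> nat. strict_mono r \<and> (x \<circ> r) \<longlonglongrightarrow> l"
  shows "closed A"
  unfolding closed_sequential_limits
proof (intro allI impI)
  fix x l assume x: "(\<forall>n. x n \<in> A) \<and> x \<longlonglongrightarrow> l"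
  then obtain l' r where "l' \<in> A" "strict_mono (r :: nat \<Rightarrow> nat)" "(x \<circ> r) \<longlonglongrightarrow> l'"
    using assms[of x] by (meson convergent_imp_bounded)
  moreover have "(x \<circ> r) \<longlonglongrightarrow> l"
    using x \<open>strict_mono r\<close> by (simp add: LIMSEQ_subseq_LIMSEQ)
  ultimately show "l \<in> A"
    using LIMSEQ_unique by blast
qed

text \<open>For nonzero \<open>c\<close>, the vector \<open>c *\<^sub>R a + y\<close> is
  \<open>c\<close> times the difference of \<open>a\<close> and a point of \<open>A\<close>, and
  \<open>a\<close> keeps a distance \<open>d > 0\<close> from \<open>A\<close>.\<close>

lemma coeff_bound_closed_subspace:
  fixes A :: "'a::real_normed_vector set"
  assumes "subspace A" "closed A" "a \<notin> A"
  shows "\<exists>K\<ge>0. \<forall>c. \<forall>y\<in>A. \<bar>c\<bar> \<le> K * norm (c *\<^sub>R a + y)"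
proof -
  have "open (- A)" "a \<in> - A"
    using assms by auto
  then obtain d where d: "d > 0" "ball a d \<subseteq> - A"
    using open_contains_ball by blast
  have "\<bar>c\<bar> \<le> (1 / d) * norm (c *\<^sub>R a + y)" if y: "y \<in> A" for c y
  proof (cases "c = 0")
    case False
    define z where "z = - (1 / c) *\<^sub>R y"
    have "z \<in> A"
      using y assms(1) by (simp add: z_def subspace_scale subspace_neg)
    then have "z \<notin> ball a d"
      using d by blast
    then have "d \<le> norm (a - z)"
      by (simp add: dist_norm)
    then have "\<bar>c\<bar> * d \<le> norm (c *\<^sub>R (a - z))"
      by (simp add: mult_left_mono)
    also have "c *\<^sub>R (a - z) = c *\<^sub>R a + y"
      using False by (simp add: z_def algebra_simps)
    finally show ?thesis
      using d by (simp add: field_simps)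
  qed (use d in simp)
  then show ?thesis
    using d by (intro exI[of _ "1 / d"]) auto
qed

text \<open>Bolzano-Weierstrass in a finite-dimensional subspace of an arbitrary normed space.
  Splitting off \<open>a\<close> leaves a bounded real sequence of coefficients and a bounded
  sequence in the smaller span; subsequences are taken for one after the other.\<close>

lemma span_bounded_seq_compact:
  fixes S :: "'a::real_normed_vector set" and x :: "nat \<Rightarrow> 'a"
  assumes "finite S" "\<And>k. x k \<in> span S" "bounded (range x)"
  shows "\<exists>l\<in>span S. \<exists>r :: nat \<Rightarrow> nat. strict_mono r \<and> (x \<circ> r) \<longlonglongrightarrow> l"
  using assms
proof (induction S arbitrary: x rule: finite_induct)
  case empty
  then have "x \<circ> id = (\<lambda>_. 0)"
    by auto
  then show ?case
    by (auto intro!: exI[of _ id] simp: strict_mono_def)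
next
  case (insert a S)
  show ?case
  proof (cases "a \<in> span S")
    case True
    then show ?thesis
      using insert.IH[of x] insert.prems by (simp add: span_redundant)
  next
    case False
    \<comment> \<open>The induction hypothesis covers all sequences in \<open>span S\<close>, so it
      gives the closedness on which the coefficient bound rests.\<close>
    have "closed (span S)"
      using insert.IH by (rule closed_if_bounded_seq_compact)
    then obtain K where K: "K \<ge> 0" "\<And>c y. y \<in> span S \<Longrightarrow> \<bar>c\<bar> \<le> K * norm (c *\<^sub>R a + y)"
      using coeff_bound_closed_subspace[OF subspace_span _ False] by blast
    have "\<forall>k. \<exists>c. x k - c *\<^sub>R a \<in> span S"
      using insert.prems(1) span_breakdown_eq by blast
    then obtain c where c: "\<And>k. x k - c k *\<^sub>R a \<in> span S"
      by metis
    obtain R where R: "\<And>k. norm (x k) \<le> R"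
      using insert.prems(2) by (auto simp: bounded_iff)
    have cR: "\<bar>c k\<bar> \<le> K * R" for k
      using K(2)[OF c[of k], of "c k"] mult_left_mono[OF R[of k] K(1)] by simp
    then have "bounded (range c)"
      by (auto simp: bounded_iff)
    then obtain l1 r1 where r1: "strict_mono (r1 :: nat \<Rightarrow> nat)" "(c \<circ> r1) \<longlonglongrightarrow> l1"
      using bounded_imp_convergent_subsequence by blast
    define y where "y k = x (r1 k) - c (r1 k) *\<^sub>R a" for k
    have "norm (y k) \<le> R + K * R * norm a" for k
      unfolding y_def
      by (rule order_trans[OF norm_triangle_ineq4]) (use R cR in \<open>auto intro!: add_mono mult_right_mono\<close>)
    then have "bounded (range y)"
      by (auto simp: bounded_iff)
    moreover have "y k \<in> span S" for k
      using c by (simp add: y_def)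
    ultimately obtain l2 r2 where r2: "l2 \<in> span S" "strict_mono (r2 :: nat \<Rightarrow> nat)" "(y \<circ> r2) \<longlonglongrightarrow> l2"
      using insert.IH by blast
    have "(c \<circ> r1 \<circ> r2) \<longlonglongrightarrow> l1"
      using r1 r2 LIMSEQ_subseq_LIMSEQ by blast
    then have "(\<lambda>k. (c \<circ> r1 \<circ> r2) k *\<^sub>R a + (y \<circ> r2) k) \<longlonglongrightarrow> l1 *\<^sub>R a + l2"
      using r2(3) by (intro tendsto_intros)
    then have "(x \<circ> (r1 \<circ> r2)) \<longlonglongrightarrow> l1 *\<^sub>R a + l2"
      by (simp add: y_def o_def)
    moreover have "l1 *\<^sub>R a + l2 \<in> span (insert a S)"
      using r2(1) by (auto simp: span_breakdown_eq intro!: exI[of _ l1])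
    moreover have "strict_mono (r1 \<circ> r2)"
      using r1 r2 strict_mono_o by blast
    ultimately show ?thesis
      by blast
  qed
qed

lemma closed_span_finite:
  fixes S :: "'a::real_normed_vector set"
  assumes "finite S"
  shows "closed (span S)"
  using span_bounded_seq_compact[OF assms] by (rule closed_if_bounded_seq_compact)

section \<open>Seminorms converging to the norm\<close>

text \<open>Uniform boundedness in finite dimension: in \<open>c *\<^sub>R a + y\<close>, the first
  term is controlled by the pointwise bound at \<open>a\<close> and the coefficient bound, the
  second by induction.\<close>

lemma seminorms_equibounded:
  fixes S :: "'a::real_normed_vector set" and p :: "nat \<Rightarrow> 'a \<Rightarrow> real"
  assumes "finite S"
    and "\<And>N x y. N \<ge> N0 \<Longrightarrow> x \<in> span S \<Longrightarrow> y \<in> span S \<Longrightarrow> p N (x + y) \<le> p N x + p N y"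
    and "\<And>N c x. N \<ge> N0 \<Longrightarrow> x \<in> span S \<Longrightarrow> p N (c *\<^sub>R x) = \<bar>c\<bar> * p N x"
    and "\<And>x. x \<in> span S \<Longrightarrow> Bseq (\<lambda>N. p N x)"
  shows "\<exists>C\<ge>0. \<forall>N\<ge>N0. \<forall>x\<in>span S. p N x \<le> C * norm x"
  using assms
proof (induction S rule: finite_induct)
  case empty
  have "p N 0 = 0" if "N \<ge> N0" for N
    using empty(2)[of N 0 0] that by simp
  then show ?case
    by (intro exI[of _ 0]) auto
next
  case (insert a S)
  have sub: "x \<in> span (insert a S)" if "x \<in> span S" for x
    using that span_mono[of S "insert a S"] by blast
  have a: "a \<in> span (insert a S)"
    by (simp add: span_base)
  have "\<exists>C\<ge>0. \<forall>N\<ge>N0. \<forall>x\<in>span S. p N x \<le> C * norm x"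
  proof (rule insert.IH)
    fix N x y assume "N \<ge> N0" "x \<in> span S" "y \<in> span S"
    then show "p N (x + y) \<le> p N x + p N y"
      by (intro insert.prems(1) sub)
  next
    fix N c x assume "N \<ge> N0" "x \<in> span S"
    then show "p N (c *\<^sub>R x) = \<bar>c\<bar> * p N x"
      by (intro insert.prems(2) sub)
  next
    fix x assume "x \<in> span S"
    then show "Bseq (\<lambda>N. p N x)"
      by (intro insert.prems(3) sub)
  qed
  then obtain C where C: "C \<ge> 0" "\<And>N x. N \<ge> N0 \<Longrightarrow> x \<in> span S \<Longrightarrow> p N x \<le> C * norm x"
    by blast
  show ?case
  proof (cases "a \<in> span S")
    case True
    then show ?thesis
      using C by (auto simp: span_redundant)
  next
    case False
    obtain K where K: "K \<ge> 0" "\<And>c y. y \<in> span S \<Longrightarrow> \<bar>c\<bar> \<le> K * norm (c *\<^sub>R a + y)"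
      using coeff_bound_closed_subspace[OF subspace_span closed_span_finite[OF insert.hyps(1)] False]
      by blast
    obtain Q where Q: "Q > 0" "\<And>N. norm (p N a) \<le> Q"
      using insert.prems(3)[OF a] unfolding Bseq_def by blast
    \<comment> \<open>The constant combines \<open>\<bar>c\<bar> \<le> K * norm x\<close> and
      \<open>p N a \<le> Q\<close> with \<open>C\<close> applied to
      \<open>norm y \<le> norm x + \<bar>c\<bar> * norm a\<close>.\<close>
    have "p N x \<le> (K * Q + C * (1 + K * norm a)) * norm x"
      if N: "N \<ge> N0" and x: "x \<in> span (insert a S)" for N x
    proof -
      obtain c where c: "x - c *\<^sub>R a \<in> span S"
        using x span_breakdown_eq by blast
      define y where "y = x - c *\<^sub>R a"
      have y: "y \<in> span S" and xy: "x = c *\<^sub>R a + y"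
        using c by (simp_all add: y_def)
      have cK: "\<bar>c\<bar> \<le> K * norm x"
        using K(2)[OF y, of c] xy by simp
      have "p N x \<le> p N (c *\<^sub>R a) + p N y"
        unfolding xy by (rule insert.prems(1)[OF N _ sub[OF y]]) (simp add: a span_scale)
      also have "\<dots> = \<bar>c\<bar> * p N a + p N y"
        using insert.prems(2)[OF N a] by simp
      also have "\<dots> \<le> (K * norm x) * Q + C * norm y"
        using cK Q(2)[of N] C(2)[OF N y] K(1) Q(1)
        by (intro add_mono order_trans[OF mult_left_mono[of "p N a" Q]] mult_right_mono) auto
      also have "\<dots> \<le> (K * norm x) * Q + C * (norm x + (K * norm x) * norm a)"
      proof (intro add_left_mono mult_left_mono C(1))
        show "norm y \<le> norm x + (K * norm x) * norm a"
          unfolding y_def by (rule order_trans[OF norm_triangle_ineq4]) (simp add: cK mult_right_mono)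
      qed
      finally show ?thesis
        by (simp add: algebra_simps)
    qed
    then show ?thesis
      using K Q C by (intro exI[of _ "K * Q + C * (1 + K * norm a)"]) auto
  qed
qed

text \<open>In the theorem, \<open>p N w\<close> is \<open>nrm N (P N w)\<close>; what follows needs
  only these properties. The axioms start at \<open>N0\<close> because the scheme does.\<close>

locale seminorms_to_norm =
  fixes W :: "'x::real_normed_vector set" and p :: "nat \<Rightarrow> 'x \<Rightarrow> real" and N0 :: nat
  assumes fin_dim: "\<exists>S. finite S \<and> W = span S"
    and triangle: "\<And>N x y. N \<ge> N0 \<Longrightarrow> x \<in> W \<Longrightarrow> y \<in> W \<Longrightarrow> p N (x + y) \<le> p N x + p N y"
    and homogeneous: "\<And>N c x. N \<ge> N0 \<Longrightarrow> x \<in> W \<Longrightarrow> p N (c *\<^sub>R x) = \<bar>c\<bar> * p N x"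
    and limit: "\<And>x. x \<in> W \<Longrightarrow> (\<lambda>N. p N x) \<longlonglongrightarrow> norm x"
begin

lemma subspace_W: "subspace W"
  using fin_dim by (auto simp: subspace_span)

text \<open>Equiboundedness gives all \<open>p N\<close> a common Lipschitz constant
  \<open>C\<close>, so replacing the moving point \<open>x k\<close> by \<open>l\<close> costs at
  most \<open>C * norm (x k - l)\<close>; pointwise convergence at \<open>l\<close> does the
  rest.\<close>

lemma tendsto_along:
  assumes "\<And>k. n k \<ge> N0" "filterlim n at_top sequentially"
    and x: "\<And>k. x k \<in> W" and lim: "x \<longlonglongrightarrow> l" and l: "l \<in> W"
  shows "(\<lambda>k. p (n k) (x k)) \<longlonglongrightarrow> norm l"
proof -
  obtain S where S: "finite S" "W = span S"
    using fin_dim by blast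
  have "Bseq (\<lambda>N. p N x)" if "x \<in> W" for x
    using limit[OF that] by (intro convergent_imp_Bseq convergentI)
  then have "\<exists>C\<ge>0. \<forall>N\<ge>N0. \<forall>x\<in>W. p N x \<le> C * norm x"
    using triangle homogeneous unfolding S(2) by (intro seminorms_equibounded[OF S(1)])
  then obtain C where C: "C \<ge> 0" "\<And>N x. N \<ge> N0 \<Longrightarrow> x \<in> W \<Longrightarrow> p N x \<le> C * norm x"
    by blast
  have diff: "p (n k) a - p (n k) b \<le> C * norm (a - b)" if "a \<in> W" "b \<in> W" for a b k
    using triangle[of "n k" "a - b" b] C(2)[of "n k" "a - b"] assms(1)[of k] that
      subspace_diff[OF subspace_W] by force
  have "norm (p (n k) (x k) - p (n k) l) \<le> C * norm (x k - l)" for k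
    using diff[OF x l] diff[OF l x] by (simp add: abs_le_iff norm_minus_commute)
  moreover have "(\<lambda>k. C * norm (x k - l)) \<longlonglongrightarrow> 0"
    using tendsto_mult_right_zero[OF tendsto_norm_zero[OF LIM_zero[OF lim]]] .
  ultimately have "(\<lambda>k. p (n k) (x k) - p (n k) l) \<longlonglongrightarrow> 0"
    by (rule Lim_null_comparison[OF always_eventually[OF allI]])
  moreover have "(\<lambda>k. p (n k) l) \<longlonglongrightarrow> norm l"
    using filterlim_compose[OF limit[OF l] assms(2)] .
  ultimately show ?thesis
    using tendsto_add[of "\<lambda>k. p (n k) (x k) - p (n k) l" 0] by fastforce
qed

lemma bounded_seq_compact:
  fixes x :: "nat \<Rightarrow> 'x"
  assumes "\<And>k. x k \<in> W" "bounded (range x)"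
  obtains l r where "l \<in> W" "strict_mono (r :: nat \<Rightarrow> nat)" "(x \<circ> r) \<longlonglongrightarrow> l"
  using span_bounded_seq_compact assms fin_dim by metis

text \<open>Normalised counterexamples would accumulate at some \<open>l\<close> of norm 1, while
  the seminorms along them stay below 1/2. The estimate serves to bound points of the
  \<open>N\<close>-th sphere in the norm of the ambient space.\<close>

lemma eventually_half_norm_le: "\<forall>\<^sub>F N in sequentially. \<forall>x\<in>W. norm x / 2 \<le> p N x"
proof (rule ccontr)
  assume "\<not> ?thesis"
  then have "\<forall>k. \<exists>N\<ge>k. \<exists>x\<in>W. p N x < norm x / 2"
    by (auto simp: eventually_sequentially not_le)
  \<comment> \<open>Starting at \<open>k + N0\<close> makes the indices both admissible and
    divergent.\<close>
  then have "\<forall>k. \<exists>N x. N \<ge> k + N0 \<and> x \<in> W \<and> p N x < norm x / 2"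
    by blast
  then obtain n x where nx: "\<And>k. n k \<ge> k + N0" "\<And>k. x k \<in> W" "\<And>k. p (n k) (x k) < norm (x k) / 2"
    by metis
  have nN0: "n k \<ge> N0" for k
    using nx(1)[of k] by simp
  define y where "y k = (1 / norm (x k)) *\<^sub>R x k" for k
  have x0: "norm (x k) > 0" for k
    using nx(3)[of k] homogeneous[OF nN0[of k] nx(2)[of k], of 0] by auto
  have y: "y k \<in> W" "norm (y k) = 1" "p (n k) (y k) < 1 / 2" for k
    using nx[of k] x0[of k] homogeneous[OF nN0[of k] nx(2)[of k]] subspace_W
    by (auto simp: y_def subspace_scale field_simps)
  have "bounded (range y)"
    using y(2) by (auto simp: bounded_iff intro!: exI[of _ 1])
  then obtain l r where lr: "l \<in> W" "strict_mono (r :: nat \<Rightarrow> nat)" "(y \<circ> r) \<longlonglongrightarrow> l"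
    using bounded_seq_compact[of y, OF y(1)] by blast
  have "filterlim n at_top sequentially"
    using nx(1) by (intro filterlim_at_top_mono[OF filterlim_ident] always_eventually allI) (rule add_leD1)
  then have "filterlim (\<lambda>k. n (r k)) at_top sequentially"
    using filterlim_compose filterlim_subseq[OF lr(2)] by blast
  then have "(\<lambda>k. p (n (r k)) (y (r k))) \<longlonglongrightarrow> norm l"
    using lr(3) by (intro tendsto_along[OF nN0 _ y(1) _ lr(1)]) (simp_all add: o_def)
  then have "norm l \<le> 1 / 2"
    using y(3) by (intro LIMSEQ_le_const2) (auto intro: less_imp_le)
  moreover have "norm l = 1"
    using tendsto_norm[OF lr(3)] y(2) by (simp add: LIMSEQ_const_iff)
  ultimately show False
    by simp
qed

end

section \<open>Trajectories of the approximation scheme\<close>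

text \<open>ODE solutions are continuous coordinate by coordinate; this expansion carries that over
  to \<open>\<phi>\<close>. The truncations \<open>tr m\<close> keep the first \<open>m\<close>
  entries of \<open>x\<close>.\<close>

lemma linear_from_vec_sum:
  assumes "linear_from_vec N \<phi>" "x \<in> carrier_vec N"
  shows "\<phi> x = (\<Sum>i<N. x $ i *\<^sub>R \<phi> (unit_vec N i))"
proof -
  define tr where "tr m = vec N (\<lambda>i. if i < m then x $ i else 0)" for m
  have "m \<le> N \<Longrightarrow> \<phi> (tr m) = (\<Sum>i<m. x $ i *\<^sub>R \<phi> (unit_vec N i))" for m
  proof (induction m)
    case 0
    have "tr 0 = 0 \<cdot>\<^sub>v tr 0" and "tr 0 \<in> carrier_vec N"
      by (auto simp: tr_def)
    then have "\<phi> (tr 0) = 0 *\<^sub>R \<phi> (tr 0)"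
      using assms(1) unfolding linear_from_vec_def by metis
    then show ?case
      by simp
  next
    case (Suc m)
    have "tr (Suc m) = tr m + x $ m \<cdot>\<^sub>v unit_vec N m"
      using Suc.prems by (intro eq_vecI) (auto simp: tr_def less_Suc_eq)
    moreover have "tr m \<in> carrier_vec N" "x $ m \<cdot>\<^sub>v unit_vec N m \<in> carrier_vec N"
      by (auto simp: tr_def)
    ultimately have "\<phi> (tr (Suc m)) = \<phi> (tr m) + x $ m *\<^sub>R \<phi> (unit_vec N m)"
      using assms(1) unfolding linear_from_vec_def by (metis unit_vec_carrier)
    then show ?case
      using Suc by simp
  qed
  moreover have "tr N = x"
    using assms(2) by (auto simp: tr_def)
  ultimately show ?thesis
    by (metis order_refl)
qed

lemma continuous_on_ode_solution:
  fixes \<phi> :: "real vec \<Rightarrow> 'x::real_normed_vector"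
  assumes "linear_from_vec N \<phi>" "ode_solution T N f z"
  shows "continuous_on {0..T} (\<lambda>t. \<phi> (z t))"
proof -
  have comp: "continuous_on {0..T} (\<lambda>t. z t $ i)" if "i < N" for i
    using assms(2) that unfolding ode_solution_def
    by (intro DERIV_continuous_on[where D = "\<lambda>t. f t (z t) $ i"]) auto
  have "continuous_on {0..T} (\<lambda>t. \<Sum>i<N. z t $ i *\<^sub>R \<phi> (unit_vec N i))"
    by (intro continuous_on_sum continuous_on_scaleR continuous_on_const comp) simp
  then show ?thesis
    using assms by (subst continuous_on_cong[OF refl linear_from_vec_sum])
      (auto simp: ode_solution_def)
qed

text \<open>Continuity on a compact interval makes the set under the supremum bounded, so that
  \<open>SUP\<close> is an upper bound.\<close>

lemma norm_le_sup_norm: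
  assumes "continuous_on {0..T} v" "t \<in> {0..T}"
  shows "norm (v t) \<le> sup_norm T v"
  unfolding sup_norm_def
proof (rule cSUP_upper[OF assms(2)])
  have "compact ((\<lambda>t. norm (v t)) ` {0..T})"
    using assms by (intro compact_continuous_image continuous_intros) auto
  then show "bdd_above ((\<lambda>t. norm (v t)) ` {0..T})"
    by (intro bounded_imp_bdd_above compact_imp_bounded)
qed

text \<open>\<open>output_dist\<close> takes the class of a pointwise difference; this turns it into
  a difference in the normed space, where limits are taken term by term.\<close>

lemma function_space_cls_diff:
  assumes "function_space S E cls" "f \<in> E" "g \<in> E"
  shows "cls (\<lambda>x. f x - g x) = cls f - cls g"
proof -
  have add: "\<forall>f\<in>E. \<forall>g\<in>E. (\<lambda>x. f x + g x) \<in> E \<and> cls (\<lambda>x. f x + g x) = cls f + cls g"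
    using assms(1) unfolding function_space_def by (elim conjE)
  have scale: "\<forall>c. \<forall>f\<in>E. (\<lambda>x. c *\<^sub>R f x) \<in> E \<and> cls (\<lambda>x. c *\<^sub>R f x) = c *\<^sub>R cls f"
    using assms(1) unfolding function_space_def by (elim conjE)
  have g: "(\<lambda>x. (- 1) *\<^sub>R g x) \<in> E" "cls (\<lambda>x. (- 1) *\<^sub>R g x) = (- 1) *\<^sub>R cls g"
    using bspec[OF spec[OF scale, of "- 1"] assms(3)] by blast+
  have "cls (\<lambda>x. f x + (- 1) *\<^sub>R g x) = cls f + cls (\<lambda>x. (- 1) *\<^sub>R g x)"
    using bspec[OF bspec[OF add assms(2)] g(1)] by (rule conjunct2)
  with g(2) show ?thesis
    by simp
qed

text \<open>The PDE solution \<open>v'\<close> from \<open>w k\<close> is the intermediate point;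
  its distances to the ODE trajectory and to \<open>v\<close> are each allotted
  \<open>e / 2\<close>.\<close>

lemma trajectories_converge:
  assumes V: "subspace_of_C0 T V" "Sol \<subseteq> V"
    and wp: "locally_well_posed T V0 Sol D0 u"
    and sch: "well_posed_scheme T N0 Sol D0 W FN P \<Phi> nrm"
    and n: "\<And>k. n k \<ge> N0" "filterlim n at_top sequentially"
    and v: "v \<in> Sol" "v 0 \<in> D0"
    and w: "\<And>k. w k \<in> D0" "w \<longlonglongrightarrow> v 0"
    and z: "\<And>k. ode_solution T (n k) (FN (n k)) (z k)" "\<And>k. z k 0 = P (n k) (w k)"
  shows "uniform_limit {0..T} (\<lambda>k t. \<Phi> (n k) (z k t)) v sequentially"
  unfolding uniform_limit_iff
proof (intro allI impI)
  fix e :: real assume "e > 0"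
  then have e2: "e / 2 > 0"
    by simp
  \<comment> \<open>The constants of the scheme depend on a bounded set of initial values;
    \<open>range w\<close> serves all \<open>k\<close> at once.\<close>
  have "bounded (range w)" "range w \<subseteq> D0"
    using w convergent_imp_bounded by auto
  then obtain M \<alpha> where M: "M > 0" "\<alpha> > 0"
    "\<And>N v z t. N \<ge> N0 \<Longrightarrow> v \<in> Sol \<Longrightarrow> v 0 \<in> range w \<Longrightarrow> ode_solution T N (FN N) z \<Longrightarrow>
       z 0 = P N (v 0) \<Longrightarrow> t \<in> {0..T} \<Longrightarrow> norm (v t - \<Phi> N (z t)) \<le> M / real N powr \<alpha>"
    using sch unfolding well_posed_scheme_def by meson
  have "\<forall>\<epsilon>>0. \<exists>\<delta>>0. \<forall>v'\<in>Sol. v' 0 \<in> D0 \<and> norm (v' 0 - v 0) < \<delta> \<longrightarrow>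
      sup_norm T (\<lambda>t. v' t - v t) < \<epsilon>"
    using wp v unfolding locally_well_posed_def by simp
  then obtain \<delta> where \<delta>: "\<delta> > 0"
    "\<And>v'. v' \<in> Sol \<Longrightarrow> v' 0 \<in> D0 \<Longrightarrow> norm (v' 0 - v 0) < \<delta> \<Longrightarrow> sup_norm T (\<lambda>t. v' t - v t) < e / 2"
    using e2 by meson
  have "(\<lambda>N. M * real N powr (- \<alpha>)) \<longlonglongrightarrow> M * 0"
    using M(2) by (intro tendsto_mult tendsto_const tendsto_neg_powr filterlim_real_sequentially) simp
  then have "((\<lambda>N. M / real N powr \<alpha>) \<longlongrightarrow> 0) sequentially"
    by (simp add: powr_minus_divide)
  then have "(\<lambda>k. M / real (n k) powr \<alpha>) \<longlonglongrightarrow> 0"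
    using n(2) by (rule filterlim_compose)
  then have ev1: "\<forall>\<^sub>F k in sequentially. M / real (n k) powr \<alpha> < e / 2"
    using e2 by (rule order_tendstoD)
  have ev2: "\<forall>\<^sub>F k in sequentially. dist (w k) (v 0) < \<delta>"
    using w(2) \<delta>(1) by (rule tendstoD)
  show "\<forall>\<^sub>F k in sequentially. \<forall>t\<in>{0..T}. dist (\<Phi> (n k) (z k t)) (v t) < e"
    using ev1 ev2
  proof eventually_elim
    case (elim k)
    obtain v' where v': "v' \<in> Sol" "v' 0 = w k"
      using wp w(1) unfolding locally_well_posed_def by blast
    have cont: "continuous_on {0..T} (\<lambda>t. v' t - v t)"
      using V v v' by (intro continuous_intros) (auto simp: subspace_of_C0_def C0_def)
    have sup: "sup_norm T (\<lambda>t. v' t - v t) < e / 2"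
      using \<delta>(2)[OF v'(1)] v' w(1) elim(2) by (simp add: dist_norm)
    show ?case
    proof
      fix t assume t: "t \<in> {0..T}"
      have "norm (v' t - \<Phi> (n k) (z k t)) \<le> M / real (n k) powr \<alpha>"
        using v' z by (intro M(3)[OF n(1) _ _ _ _ t]) auto
      moreover have "dist (\<Phi> (n k) (z k t)) (v t) \<le> norm (v' t - v t) + norm (v' t - \<Phi> (n k) (z k t))"
        using norm_triangle_ineq4[of "v' t - v t" "v' t - \<Phi> (n k) (z k t)"] by (simp add: dist_norm)
      ultimately show "dist (\<Phi> (n k) (z k t)) (v t) < e"
        using norm_le_sup_norm[OF cont t] sup elim(1) by linarith
    qed
  qed
qed

text \<open>Both arguments vary, because the approximate nominal trajectory changes with the
  dimension. Output continuity makes each output converge in \<open>'y\<close>, and the norm of a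
  difference is continuous.\<close>

lemma output_dist_converges:
  fixes clsY :: "(real \<Rightarrow> 'q::real_vector) \<Rightarrow> 'y::real_normed_vector"
  assumes fs: "function_space I fnsY clsY"
    and out: "\<forall>v \<in> V \<union> A. (\<lambda>t. H (v t)) \<in> fnsY"
    and cont: "output_continuous_in T V clsY H A"
    and x: "\<And>k. x k \<in> A" "uniform_limit {0..T} x v sequentially" "v \<in> V"
    and y: "\<And>k. y k \<in> A" "uniform_limit {0..T} y u sequentially" "u \<in> V"
  shows "(\<lambda>k. output_dist clsY H (x k) (y k)) \<longlonglongrightarrow> output_dist clsY H v u"
proof -
  have diff: "output_dist clsY H a b = norm (clsY (\<lambda>t. H (a t)) - clsY (\<lambda>t. H (b t)))"
    if "a \<in> V \<union> A" "b \<in> V \<union> A" for a b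
    using function_space_cls_diff[OF fs, of "\<lambda>t. H (a t)" "\<lambda>t. H (b t)"] out that
    by (simp add: output_dist_def)
  have "(\<lambda>k. output_dist clsY H (x k) v) \<longlonglongrightarrow> 0" "(\<lambda>k. output_dist clsY H (y k) u) \<longlonglongrightarrow> 0"
    using cont x y unfolding output_continuous_in_def by auto
  then have "(\<lambda>k. clsY (\<lambda>t. H (x k t))) \<longlonglongrightarrow> clsY (\<lambda>t. H (v t))"
    "(\<lambda>k. clsY (\<lambda>t. H (y k t))) \<longlonglongrightarrow> clsY (\<lambda>t. H (u t))"
    using diff x y by (auto simp: tendsto_norm_zero_iff LIM_zero_iff)
  then have "(\<lambda>k. norm (clsY (\<lambda>t. H (x k t)) - clsY (\<lambda>t. H (y k t))))
      \<longlonglongrightarrow> norm (clsY (\<lambda>t. H (v t)) - clsY (\<lambda>t. H (u t)))"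
    by (intro tendsto_intros)
  then show ?thesis
    using diff x y by simp
qed

theorem theorem1:
  fixes \<Omega> :: "(real ^ 'n::finite) set"
    and T t0 t1 \<rho> :: real
    and fnsX :: "(real ^ 'n \<Rightarrow> 'b::euclidean_space) set"
    and clsX :: "(real ^ 'n \<Rightarrow> 'b) \<Rightarrow> 'x::banach"
    and V0 D0 W :: "'x set"
    and V Sol :: "(real \<Rightarrow> 'x) set"
    and r :: nat
    and F :: "real \<Rightarrow> ('n list \<Rightarrow> 'b) \<Rightarrow> 'b"
    and fnsY :: "(real \<Rightarrow> real ^ 'p::finite) set"
    and clsY :: "(real \<Rightarrow> real ^ 'p) \<Rightarrow> 'y::real_normed_vector"
    and H :: "'x \<Rightarrow> real ^ 'p"
    and e :: "nat \<Rightarrow> 'x"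
    and s N0 :: nat
    and FN :: "nat \<Rightarrow> real \<Rightarrow> real vec \<Rightarrow> real vec"
    and P :: "nat \<Rightarrow> 'x \<Rightarrow> real vec"
    and \<Phi> :: "nat \<Rightarrow> real vec \<Rightarrow> 'x"
    and nrm :: "nat \<Rightarrow> real vec \<Rightarrow> real"
    and u :: "real \<Rightarrow> 'x"
    and uN :: "nat \<Rightarrow> real \<Rightarrow> real vec"
  assumes "open \<Omega>" and "T > 0"
    and "function_space \<Omega> fnsX clsX"
    and "subspace V0" and "subspace_of_C0 T V"
    and "pde_rhs T r F" and "pde_solutions \<Omega> T fnsX clsX r F V Sol"
    and "0 \<le> t0" and "t0 \<le> t1" and "t1 \<le> T"
    and "function_space {t0..t1} fnsY clsY"
    and outputs: "\<forall>v \<in> V \<union> C0 T (\<Union>N\<in>{N0..}. \<Phi> N ` carrier_vec N). (\<lambda>t. H (v t)) \<in> fnsY"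
    and "s \<ge> 1" and "inj_on e {1..s}" and "independent (e ` {1..s})"
    and "W = span (e ` {1..s})" and "W \<subseteq> V0"
    and "u \<in> Sol" and "locally_well_posed T V0 Sol D0 u"
    and "N0 > 0" and "approximation_scheme T N0 V0 D0 FN P \<Phi> nrm"
    and "well_posed_scheme T N0 Sol D0 W FN P \<Phi> nrm"
    and "output_continuous_in T V clsY H (C0 T (\<Union>N\<in>{N0..}. \<Phi> N ` carrier_vec N))"
    and "\<rho> > 0" and "u 0 \<in> W \<inter> D0"
    and "{w \<in> W. norm (w - u 0) = \<rho>} \<subseteq> D0"
    and "\<forall>N\<ge>N0. ode_solution T N (FN N) (uN N) \<and> uN N 0 = P N (u 0)"
    and "\<forall>N\<ge>N0. {w \<in> P N ` W. nrm N (w - uN N 0) = \<rho>} \<subseteq> P N ` D0"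
  shows "(\<lambda>N. obs_eps_N clsY H T N (FN N) (\<Phi> N) (nrm N) (P N ` W) (uN N) \<rho>)
           \<longlonglongrightarrow> obs_eps clsY H Sol W D0 u \<rho>"
proof -
  let ?A = "C0 T (\<Union>N\<in>{N0..}. \<Phi> N ` carrier_vec N)"
  let ?eps = "obs_eps clsY H Sol W D0 u \<rho>"
  let ?epsN = "\<lambda>N. obs_eps_N clsY H T N (FN N) (\<Phi> N) (nrm N) (P N ` W) (uN N) \<rho>"
  let ?D = "\<lambda>N z. output_dist clsY H (\<lambda>t. \<Phi> N (z t)) (\<lambda>t. \<Phi> N (uN N t))"
  note wp = \<open>locally_well_posed T V0 Sol D0 u\<close>
  note sch = \<open>well_posed_scheme T N0 Sol D0 W FN P \<Phi> nrm\<close>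
  note asch = \<open>approximation_scheme T N0 V0 D0 FN P \<Phi> nrm\<close>
  note D0sphere = \<open>{w \<in> W. norm (w - u 0) = \<rho>} \<subseteq> D0\<close>
  have uN: "ode_solution T N (FN N) (uN N)" "uN N 0 = P N (u 0)" if "N \<ge> N0" for N
    using \<open>\<forall>N\<ge>N0. ode_solution T N (FN N) (uN N) \<and> uN N 0 = P N (u 0)\<close> that by blast+
  have u0: "u 0 \<in> W" "u 0 \<in> D0"
    using \<open>u 0 \<in> W \<inter> D0\<close> by auto
  have SolV: "Sol \<subseteq> V"
    using \<open>pde_solutions \<Omega> T fnsX clsX r F V Sol\<close> unfolding pde_solutions_def by blast
  have subW: "subspace W"
    using \<open>W = span (e ` {1..s})\<close> by simp
  have linP: "linear_to_vec N V0 (P N)" and lin\<Phi>: "linear_from_vec N (\<Phi> N)"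
    and nrm: "vec_norm_on N (nrm N)" and ex_ode: "\<And>z. z \<in> P N ` D0 \<Longrightarrow> \<exists>v. ode_solution T N (FN N) v \<and> v 0 = z"
    if "N \<ge> N0" for N
    using asch that unfolding approximation_scheme_def by blast+
  have PV: "P N w \<in> carrier_vec N" if "N \<ge> N0" "w \<in> W" for N w
    using linP that \<open>W \<subseteq> V0\<close> unfolding linear_to_vec_def by blast
  have Padd: "P N (v + w) = P N v + P N w" if "N \<ge> N0" "v \<in> W" "w \<in> W" for N v w
    using linP that \<open>W \<subseteq> V0\<close> unfolding linear_to_vec_def by blast
  have Pscale: "P N (c *\<^sub>R w) = c \<cdot>\<^sub>v P N w" if "N \<ge> N0" "w \<in> W" for N c w
    using linP that \<open>W \<subseteq> V0\<close> unfolding linear_to_vec_def by blast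
  have Pdiff: "P N (v - w) = P N v - P N w" if "N \<ge> N0" "v \<in> W" "w \<in> W" for N v w
  proof -
    have "P N v = P N (v - w) + P N w"
      using Padd[of N "v - w" w] that subW by (simp add: subspace_diff)
    then show ?thesis
      using PV[of N "v - w"] PV[of N w] that subW by (intro eq_vecI) (auto simp: subspace_diff)
  qed

  \<comment> \<open>The seminorms \<open>nrm N (P N w)\<close> on \<open>W\<close>\<close>
  define p where "p N w = nrm N (P N w)" for N w
  interpret seminorms_to_norm W p N0
  proof
    show "\<exists>S. finite S \<and> W = span S"
      using \<open>W = span (e ` {1..s})\<close> by blast
  next
    fix N x y assume "N \<ge> N0" "x \<in> W" "y \<in> W"
    then show "p N (x + y) \<le> p N x + p N y"
      using nrm[of N] PV Padd unfolding p_def vec_norm_on_def by simp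
  next
    fix N c x assume "N \<ge> N0" "x \<in> W"
    then show "p N (c *\<^sub>R x) = \<bar>c\<bar> * p N x"
      using nrm[of N] PV Pscale unfolding p_def vec_norm_on_def by simp
  next
    fix x assume x: "x \<in> W"
    have "\<forall>w\<in>W. \<exists>a. a \<longlonglongrightarrow> (0::real) \<and> (\<forall>N\<ge>N0. norm w = p N w + a N * p N w)"
      using sch unfolding well_posed_scheme_def p_def by (rule conjunct2)
    from bspec[OF this x] obtain a :: "nat \<Rightarrow> real"
      where a: "a \<longlonglongrightarrow> 0" "\<And>N. N \<ge> N0 \<Longrightarrow> norm x = p N x + a N * p N x"
      by auto
    \<comment> \<open>The identity \<open>norm x = (1 + a N) * p N x\<close> can be solved for
      \<open>p N x\<close> once \<open>1 + a N\<close> is positive.\<close>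
    have ev: "\<forall>\<^sub>F N in sequentially. - 1 < a N"
      using order_tendstoD(1)[OF a(1), of "- 1"] by simp
    have "(\<lambda>N. norm x / (1 + a N)) \<longlonglongrightarrow> norm x / (1 + 0)"
      using a(1) by (intro tendsto_intros) auto
    moreover have "\<forall>\<^sub>F N in sequentially. norm x / (1 + a N) = p N x"
      using ev eventually_ge_at_top[of N0]
    proof eventually_elim
      case (elim N)
      then show ?case
        using a(2)[of N] by (simp add: field_simps)
    qed
    ultimately show "(\<lambda>N. p N x) \<longlonglongrightarrow> norm x"
      using Lim_transform_eventually by fastforce
  qed
  \<comment> \<open>Spheres around \<open>uN N 0\<close> in the image of \<open>W\<close> become
    level sets of \<open>p N\<close> around \<open>u 0\<close> in \<open>W\<close>.\<close>
  have nrm_p: "nrm N (P N w - uN N 0) = p N (w - u 0)" if "N \<ge> N0" "w \<in> W" for N w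
    using that u0 uN(2) Pdiff by (simp add: p_def)
  \<comment> \<open>\<open>D0\<close> is open only relative to \<open>V0\<close>, which suffices
    because \<open>W\<close> lies in \<open>V0\<close>.\<close>
  have near_D0: "\<forall>\<^sub>F k in sequentially. w k \<in> D0"
    if w: "\<And>k. w k \<in> W" "w \<longlonglongrightarrow> l" and l: "l \<in> D0" for w :: "nat \<Rightarrow> 'x" and l
  proof -
    obtain U where U: "open U" "D0 = V0 \<inter> U"
      using wp unfolding locally_well_posed_def openin_open by blast
    have "\<forall>\<^sub>F k in sequentially. w k \<in> U"
      using topological_tendstoD[OF w(2) U(1)] l U(2) by blast
    then show ?thesis
      by eventually_elim (use w(1) \<open>W \<subseteq> V0\<close> U(2) in blast)
  qed

  \<comment> \<open>Convergence of output distances along the scheme\<close>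
  have in_A: "(\<lambda>t. \<Phi> N (z t)) \<in> ?A" if "N \<ge> N0" "ode_solution T N (FN N) z" for N z
  proof -
    have "z t \<in> carrier_vec N" if "t \<in> {0..T}" for t
      using \<open>ode_solution T N (FN N) z\<close> that by (simp add: ode_solution_def)
    then have "(\<lambda>t. \<Phi> N (z t)) ` {0..T} \<subseteq> (\<Union>N\<in>{N0..}. \<Phi> N ` carrier_vec N)"
      using \<open>N \<ge> N0\<close> by auto
    then show ?thesis
      using continuous_on_ode_solution[OF lin\<Phi>[OF that(1)] that(2)] by (simp add: C0_def)
  qed
  have dist_conv: "(\<lambda>k. ?D (n k) (z k)) \<longlonglongrightarrow> output_dist clsY H v u"
    if n: "\<And>k. n k \<ge> N0" "filterlim n at_top sequentially" and v: "v \<in> Sol" "v 0 \<in> D0"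
      and w: "\<And>k. w k \<in> D0" "w \<longlonglongrightarrow> v 0"
      and z: "\<And>k. ode_solution T (n k) (FN (n k)) (z k)" "\<And>k. z k 0 = P (n k) (w k)"
    for n v w z
  proof (rule output_dist_converges[OF \<open>function_space {t0..t1} fnsY clsY\<close> outputs
        \<open>output_continuous_in T V clsY H ?A\<close>])
    show "uniform_limit {0..T} (\<lambda>k t. \<Phi> (n k) (z k t)) v sequentially"
      by (rule trajectories_converge[OF \<open>subspace_of_C0 T V\<close> SolV wp sch n v w z])
    show "uniform_limit {0..T} (\<lambda>k t. \<Phi> (n k) (uN (n k) t)) u sequentially"
      using u0(2) \<open>u \<in> Sol\<close> n uN
      by (intro trajectories_converge[OF \<open>subspace_of_C0 T V\<close> SolV wp sch, where w = "\<lambda>_. u 0"]) auto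
    show "v \<in> V" "u \<in> V"
      using v \<open>u \<in> Sol\<close> SolV by auto
  qed (intro in_A n z uN)+

  \<comment> \<open>The sets of competing output distances\<close>
  define valN where "valN N = {?D N z | z. ode_solution T N (FN N) z \<and> z 0 \<in> P N ` W
      \<and> nrm N (z 0 - uN N 0) = \<rho>}" for N
  define val where "val = {output_dist clsY H v u | v. v \<in> Sol \<and> v 0 \<in> W \<inter> D0 \<and> norm (v 0 - u 0) = \<rho>}"
  have eps: "?eps = Inf val" "\<And>N. ?epsN N = Inf (valN N)"
    by (simp_all add: obs_eps_def obs_eps_N_def val_def valN_def)
  have bdd: "bdd_below val" "\<And>N. bdd_below (valN N)"
    by (auto simp: val_def valN_def output_dist_def intro!: bdd_belowI[of _ 0])
  \<comment> \<open>\<open>Inf\<close> is informative only on a nonempty set. The witness moves from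
    \<open>u 0\<close> by length \<open>\<rho>\<close> along \<open>e 1\<close>, which is nonzero by
    independence.\<close>
  have "val \<noteq> {}"
  proof -
    have e1: "e 1 \<in> W" "e 1 \<noteq> 0"
      using \<open>s \<ge> 1\<close> \<open>W = span (e ` {1..s})\<close> \<open>independent (e ` {1..s})\<close> dependent_zero[of "e ` {1..s}"]
      by (auto intro!: span_base)
    define w where "w = u 0 + (\<rho> / norm (e 1)) *\<^sub>R e 1"
    have w: "w \<in> W" "norm (w - u 0) = \<rho>"
      using e1 u0 subW \<open>\<rho> > 0\<close> by (auto simp: w_def subspace_add subspace_scale)
    then have "w \<in> D0"
      using D0sphere by blast
    moreover from this obtain v where "v \<in> Sol" "v 0 = w"
      using wp unfolding locally_well_posed_def by blast
    ultimately show ?thesis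
      using w by (auto simp: val_def)
  qed

  \<comment> \<open>The bound limsup \<open>\<epsilon>\<^sup>N\<close> \<le> \<epsilon>\<close>
  have upper: "\<forall>\<^sub>F N in sequentially. valN N \<noteq> {} \<and> ?epsN N < b" if b: "?eps < b" for b
  proof -
    obtain v where v: "v \<in> Sol" "v 0 \<in> W" "v 0 \<in> D0" "norm (v 0 - u 0) = \<rho>" "output_dist clsY H v u < b"
      using cInf_lessD[OF \<open>val \<noteq> {}\<close>, of b] b eps(1) by (auto simp: val_def)
    define d where "d = v 0 - u 0"
    have d: "d \<in> W" "norm d = \<rho>"
      using v u0 subW by (auto simp: d_def subspace_diff)
    \<comment> \<open>The factor puts \<open>w N\<close> exactly on the level set
      \<open>\<rho>\<close> of \<open>p N\<close>. Since \<open>p N d\<close> tends to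
      \<open>norm d = \<rho>\<close>, it tends to 1 and \<open>w N\<close> to
      \<open>v 0\<close>.\<close>
    define w where "w N = u 0 + (\<rho> / p N d) *\<^sub>R d" for N
    have wW: "w N \<in> W" for N
      using d u0 subW by (simp add: w_def subspace_add subspace_scale)
    have "w \<longlonglongrightarrow> u 0 + (\<rho> / norm d) *\<^sub>R d"
      unfolding w_def using d \<open>\<rho> > 0\<close> by (intro tendsto_intros limit) auto
    then have wlim: "w \<longlonglongrightarrow> v 0"
      using d \<open>\<rho> > 0\<close> by (simp add: d_def)
    have "\<forall>\<^sub>F N in sequentially. p N d > 0"
      using order_tendstoD(1)[OF limit[OF d(1)], of 0] d \<open>\<rho> > 0\<close> by simp
    then have "\<forall>\<^sub>F N in sequentially. N \<ge> N0 \<and> w N \<in> D0 \<and> p N d > 0"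
      using near_D0[OF wW wlim v(3)] eventually_ge_at_top[of N0] by eventually_elim simp
    then obtain K where K: "\<And>N. N \<ge> K \<Longrightarrow> N \<ge> N0 \<and> w N \<in> D0 \<and> p N d > 0"
      unfolding eventually_sequentially by blast
    \<comment> \<open>The shift by \<open>K\<close> makes every term, not just almost every one,
      satisfy the conditions of \<open>dist_conv\<close>.\<close>
    have "\<exists>z. ode_solution T (k + K) (FN (k + K)) z \<and> z 0 = P (k + K) (w (k + K))" for k
      using K[of "k + K"] ex_ode[of "k + K"] by simp
    then obtain z where z: "\<And>k. ode_solution T (k + K) (FN (k + K)) (z k)"
      "\<And>k. z k 0 = P (k + K) (w (k + K))"
      by metis
    have "(\<lambda>k. ?D (k + K) (z k)) \<longlonglongrightarrow> output_dist clsY H v u"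
      using K v z wlim filterlim_add_const_nat_at_top[of K]
      by (intro dist_conv[where w = "\<lambda>k. w (k + K)"]) (auto intro: LIMSEQ_ignore_initial_segment)
    then have "\<forall>\<^sub>F k in sequentially. ?D (k + K) (z k) < b"
      using v(5) by (rule order_tendstoD)
    \<comment> \<open>Nonemptiness is recorded because the lower bound extracts near-minimisers from
      \<open>valN N\<close>.\<close>
    then have "\<forall>\<^sub>F k in sequentially. valN (k + K) \<noteq> {} \<and> ?epsN (k + K) < b"
    proof eventually_elim
      case (elim k)
      have k: "k + K \<ge> N0" "p (k + K) d > 0"
        using K[of "k + K"] by auto
      have "nrm (k + K) (z k 0 - uN (k + K) 0) = p (k + K) ((\<rho> / p (k + K) d) *\<^sub>R d)"
        using nrm_p[OF k(1) wW] z by (simp add: w_def)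
      also have "\<dots> = \<rho>"
        using homogeneous[OF k(1) d(1)] k(2) \<open>\<rho> > 0\<close> by simp
      finally have "?D (k + K) (z k) \<in> valN (k + K)"
        using z wW by (auto simp: valN_def)
      then show ?case
        using cInf_lower[OF _ bdd(2)] elim eps(2) by fastforce
    qed
    then show ?thesis
      by (rule eventually_sequentially_seg[THEN iffD1])
  qed

  \<comment> \<open>The bound liminf \<open>\<epsilon>\<^sup>N\<close> \<ge> \<epsilon>\<close>
  have lower: "\<forall>\<^sub>F N in sequentially. b < ?epsN N" if b: "b < ?eps" for b
  proof (rule ccontr)
    assume neg: "\<not> ?thesis"
    \<comment> \<open>Distances below \<open>c\<close> have a limit at most \<open>c\<close>, which
      still contradicts \<open>c < ?eps\<close>.\<close>
    obtain c where c: "b < c" "c < ?eps"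
      using b dense by blast
    \<comment> \<open>\<open>upper\<close> is applied at \<open>?eps + 1\<close>, only for the
      nonemptiness it yields.\<close>
    have "\<forall>\<^sub>F N in sequentially. N \<ge> N0 \<and> valN N \<noteq> {} \<and> (\<forall>x\<in>W. norm x / 2 \<le> p N x)"
      using upper[OF less_add_one] eventually_ge_at_top[of N0] eventually_half_norm_le
      by eventually_elim simp
    then obtain K where K: "\<And>N. N \<ge> K \<Longrightarrow> N \<ge> N0 \<and> valN N \<noteq> {} \<and> (\<forall>x\<in>W. norm x / 2 \<le> p N x)"
      unfolding eventually_sequentially by blast
    \<comment> \<open>The initial vectors \<open>z 0\<close> live in spaces of different dimensions,
      so they are lifted to points \<open>w\<close> of \<open>W\<close>, where a limit can be
      sought.\<close>
    have "\<exists>N z w. N \<ge> k + K \<and> ode_solution T N (FN N) z \<and> w \<in> W \<and> z 0 = P N w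
        \<and> p N (w - u 0) = \<rho> \<and> ?D N z < c" for k
    proof -
      obtain N where N: "N \<ge> k + K" "?epsN N \<le> b"
        using neg unfolding eventually_sequentially by (meson not_le)
      then have "Inf (valN N) < c" "valN N \<noteq> {}" "N \<ge> N0"
        using c eps(2) K[of N] by auto
      then obtain d where "d \<in> valN N" "d < c"
        using cInf_lessD by blast
      then obtain z w where "ode_solution T N (FN N) z" "w \<in> W" "z 0 = P N w"
        "nrm N (z 0 - uN N 0) = \<rho>" "?D N z < c"
        by (auto simp: valN_def)
      then show ?thesis
        using N(1) nrm_p[OF \<open>N \<ge> N0\<close>]
        by (intro exI[of _ N] exI[of _ z] exI[of _ w]) simp
    qed
    then obtain n z w where nzw: "\<And>k. n k \<ge> k + K" "\<And>k. ode_solution T (n k) (FN (n k)) (z k)"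
      "\<And>k. w k \<in> W" "\<And>k. z k 0 = P (n k) (w k)" "\<And>k. p (n k) (w k - u 0) = \<rho>"
      "\<And>k. ?D (n k) (z k) < c"
      by metis
    have nN0: "n k \<ge> N0" for k
      using K[of "n k"] nzw(1)[of k] by simp
    have dW: "w k - u 0 \<in> W" for k
      using nzw(3) u0 subW by (simp add: subspace_diff)
    have "norm (w k - u 0) \<le> 2 * \<rho>" for k
      using K[of "n k"] nzw(1)[of k] nzw(5)[of k] dW[of k] by force
    then have "bounded (range (\<lambda>k. w k - u 0))"
      by (auto simp: bounded_iff)
    then obtain l r where lr: "l \<in> W" "strict_mono (r :: nat \<Rightarrow> nat)" "((\<lambda>k. w k - u 0) \<circ> r) \<longlonglongrightarrow> l"
      using bounded_seq_compact[of "\<lambda>k. w k - u 0", OF dW] by blast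
    have nlim: "filterlim n at_top sequentially"
      using nzw(1) by (intro filterlim_at_top_mono[OF filterlim_ident] always_eventually allI) (rule add_leD1)
    have rlim: "filterlim (\<lambda>k. n (r k)) at_top sequentially"
      using filterlim_compose[OF nlim filterlim_subseq[OF lr(2)]] .
    \<comment> \<open>This sequence is constantly \<open>\<rho>\<close>, so \<open>u 0 + l\<close>
      lies on the limiting sphere and hence in \<open>D0\<close>.\<close>
    have "(\<lambda>k. p (n (r k)) (w (r k) - u 0)) \<longlonglongrightarrow> norm l"
      using nN0 rlim dW lr by (intro tendsto_along) (auto simp: o_def)
    then have l: "norm l = \<rho>"
      by (simp add: nzw(5) LIMSEQ_const_iff)
    define x where "x = u 0 + l"
    have "x \<in> W"
      using lr(1) u0 subW by (simp add: x_def subspace_add)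
    then have "x \<in> D0"
      using D0sphere l by (auto simp: x_def)
    then obtain v where v: "v \<in> Sol" "v 0 = x"
      using wp unfolding locally_well_posed_def by blast
    have "(\<lambda>k. u 0 + ((\<lambda>k. w k - u 0) \<circ> r) k) \<longlonglongrightarrow> x"
      unfolding x_def using lr(3) by (intro tendsto_intros)
    then have wlim: "(\<lambda>k. w (r k)) \<longlonglongrightarrow> x"
      by (simp add: o_def)
    \<comment> \<open>The lifts \<open>w k\<close> were chosen only in \<open>W\<close>; convergence
      to \<open>x\<close> puts a tail of the subsequence into \<open>D0\<close>.\<close>
    then obtain J where J: "\<And>k. k \<ge> J \<Longrightarrow> w (r k) \<in> D0"
      using near_D0[OF _ wlim \<open>x \<in> D0\<close>] nzw(3) unfolding eventually_sequentially by blast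
    have "(\<lambda>k. ?D (n (r (k + J))) (z (r (k + J)))) \<longlonglongrightarrow> output_dist clsY H v u"
      using nN0 nzw J v \<open>x \<in> D0\<close> LIMSEQ_ignore_initial_segment[OF wlim, of J]
        filterlim_compose[OF rlim filterlim_add_const_nat_at_top[of J]]
      by (intro dist_conv[where w = "\<lambda>k. w (r (k + J))"]) auto
    then have "output_dist clsY H v u \<le> c"
      using nzw(6) by (intro LIMSEQ_le_const2) (auto intro: less_imp_le)
    moreover have "output_dist clsY H v u \<in> val"
      using v \<open>x \<in> W\<close> \<open>x \<in> D0\<close> l by (auto simp: val_def x_def)
    ultimately show False
      using cInf_lower[OF _ bdd(1)] c(2) eps(1) by fastforce
  qed
  show ?thesis
  proof (rule order_tendstoI)
    fix b assume "?eps < b"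
    from upper[OF this] show "\<forall>\<^sub>F N in sequentially. ?epsN N < b"
      by eventually_elim simp
  qed (rule lower)
qed

end
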